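(* Let $(\zeta^{(k)})_{k\in\mathbb{N}}$ be a sequence of pairwise distinct elements of the unit sphere of $\ell^2$ that is dense in this unit sphere, and let $B:\ell^1\to\ell^2$ be the bounded linear operator $Bx=\sum_{k=1}^\infty x_k\,\zeta^{(k)}$ for $x=(x_1,x_2,\ldots)\in\ell^1$. Let $y\in\ell^2$. If there is no $k\in\mathbb{N}$ such that $y$ is a scalar multiple of $\zeta^{(k)}$, then there is no minimum-norm solution of $Bx=y$, i.e. there is no $x_{mn}\in\ell^1$ with $Bx_{mn}=y$ and $$\|x_{mn}\|_{\ell^1}=\min_{\{x\in\ell^1:\,Bx=y\}}\|x\|_{\ell^1}.$$
   Context: The sequence spaces $\ell^1$ and $\ell^2$ (indexed by $\mathbb{N}=\{1,2,\ldots\}$) are real, with their usual norms. The operator $B$ is a Mazur-type operator and is surjective onto $\ell^2$. *)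

theory Defs
  imports "HOL-Analysis.Analysis"
begin

text \<open>Sequences are indexed by all of \<^typ>\<open>nat\<close>, so the index $k \ge 1$ is shifted to $k - 1$.\<close>

typedef ell1 = "{x :: nat \<Rightarrow> real. summable (\<lambda>k. \<bar>x k\<bar>)}"
  morphisms ell1_nth Abs_ell1
  by (rule exI[of _ "\<lambda>_. 0"]) simp

setup_lifting type_definition_ell1

lemma summable_ell1: "summable (\<lambda>k. \<bar>ell1_nth x k\<bar>)"
  using ell1_nth[of x] by simp

instantiation ell1 :: real_normed_vector
begin

lift_definition zero_ell1 :: ell1 is "\<lambda>_. 0"
  by simp

lift_definition plus_ell1 :: "ell1 \<Rightarrow> ell1 \<Rightarrow> ell1" is "\<lambda>x y k. x k + y k"
proof -
  fix x y :: "nat \<Rightarrow> real"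
  assume "summable (\<lambda>k. \<bar>x k\<bar>)" "summable (\<lambda>k. \<bar>y k\<bar>)"
  then have "summable (\<lambda>k. \<bar>x k\<bar> + \<bar>y k\<bar>)" by (rule summable_add)
  then show "summable (\<lambda>k. \<bar>x k + y k\<bar>)"
    by (rule summable_comparison_test') auto
qed

lift_definition uminus_ell1 :: "ell1 \<Rightarrow> ell1" is "\<lambda>x k. - x k"
  by simp

lift_definition minus_ell1 :: "ell1 \<Rightarrow> ell1 \<Rightarrow> ell1" is "\<lambda>x y k. x k - y k"
proof -
  fix x y :: "nat \<Rightarrow> real"
  assume "summable (\<lambda>k. \<bar>x k\<bar>)" "summable (\<lambda>k. \<bar>y k\<bar>)"
  then have "summable (\<lambda>k. \<bar>x k\<bar> + \<bar>y k\<bar>)" by (rule summable_add)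
  then show "summable (\<lambda>k. \<bar>x k - y k\<bar>)"
    by (rule summable_comparison_test') auto
qed

lift_definition scaleR_ell1 :: "real \<Rightarrow> ell1 \<Rightarrow> ell1" is "\<lambda>c x k. c * x k"
  by (simp add: abs_mult summable_mult)

definition norm_ell1 :: "ell1 \<Rightarrow> real" where
  "norm_ell1 x = (\<Sum>k. \<bar>ell1_nth x k\<bar>)"

definition dist_ell1 :: "ell1 \<Rightarrow> ell1 \<Rightarrow> real" where
  "dist_ell1 x y = norm (x - y)"

definition sgn_ell1 :: "ell1 \<Rightarrow> ell1" where
  "sgn_ell1 x = inverse (norm x) *\<^sub>R x"

definition uniformity_ell1 :: "(ell1 \<times> ell1) filter" where
  "uniformity_ell1 = (INF e\<in>{0 <..}. principal {(x, y). dist x y < e})"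

definition open_ell1 :: "ell1 set \<Rightarrow> bool" where
  "open_ell1 U = (\<forall>x\<in>U. eventually (\<lambda>(x', y). x' = x \<longrightarrow> y \<in> U) uniformity)"

instance
proof
  fix x y z :: ell1 and a b :: real
  show "x + y + z = x + (y + z)" "x + y = y + x" "0 + x = x" "- x + x = 0" "x - y = x + - y"
    "a *\<^sub>R (x + y) = a *\<^sub>R x + a *\<^sub>R y" "(a + b) *\<^sub>R x = a *\<^sub>R x + b *\<^sub>R x"
    "a *\<^sub>R b *\<^sub>R x = (a * b) *\<^sub>R x" "1 *\<^sub>R x = x"
    by (transfer; simp add: algebra_simps)+
  show "dist x y = norm (x - y)" by (rule dist_ell1_def)
  show "sgn x = inverse (norm x) *\<^sub>R x" by (rule sgn_ell1_def)
  show "(uniformity :: (ell1 \<times> ell1) filter) = (INF e\<in>{0 <..}. principal {(x, y). dist x y < e})"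
    by (rule uniformity_ell1_def)
  show "norm x = 0 \<longleftrightarrow> x = 0"
    unfolding norm_ell1_def
    by (subst suminf_eq_zero_iff[OF summable_ell1])
      (auto simp: zero_ell1.rep_eq ell1_nth_inject[symmetric] fun_eq_iff)
  show "norm (x + y) \<le> norm x + norm y"
    unfolding norm_ell1_def
    by (subst suminf_add[OF summable_ell1 summable_ell1], rule suminf_le[OF _ summable_ell1])
      (auto simp: plus_ell1.rep_eq intro: summable_add summable_ell1)
  show "norm (a *\<^sub>R x) = \<bar>a\<bar> * norm x"
    unfolding norm_ell1_def
    by (simp add: scaleR_ell1.rep_eq abs_mult suminf_mult summable_ell1)
  show "open U = (\<forall>x\<in>U. \<forall>\<^sub>F (x', y) in uniformity. x' = x \<longrightarrow> y \<in> U)" for U :: "ell1 set"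
    by (rule open_ell1_def)
qed

end

typedef ell2 = "{x :: nat \<Rightarrow> real. summable (\<lambda>k. (x k)\<^sup>2)}"
  morphisms ell2_nth Abs_ell2
  by (rule exI[of _ "\<lambda>_. 0"]) simp

setup_lifting type_definition_ell2

lemma summable_ell2: "summable (\<lambda>k. (ell2_nth x k)\<^sup>2)"
  using ell2_nth[of x] by simp

lemma square_summable_mult:
  fixes x y :: "nat \<Rightarrow> real"
  assumes "summable (\<lambda>k. (x k)\<^sup>2)" "summable (\<lambda>k. (y k)\<^sup>2)"
  shows "summable (\<lambda>k. x k * y k)"
proof (rule summable_comparison_test')
  show "summable (\<lambda>k. (x k)\<^sup>2 + (y k)\<^sup>2)" using assms by (rule summable_add)
  fix k
  have "2 * (\<bar>x k\<bar> * \<bar>y k\<bar>) \<le> (x k)\<^sup>2 + (y k)\<^sup>2"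
    using sum_squares_bound[of "\<bar>x k\<bar>" "\<bar>y k\<bar>"] by simp
  moreover have "0 \<le> \<bar>x k\<bar> * \<bar>y k\<bar>" by simp
  ultimately show "norm (x k * y k) \<le> (x k)\<^sup>2 + (y k)\<^sup>2"
    by (simp only: real_norm_def abs_mult)
qed

lemma square_summable_add:
  fixes x y :: "nat \<Rightarrow> real"
  assumes "summable (\<lambda>k. (x k)\<^sup>2)" "summable (\<lambda>k. (y k)\<^sup>2)"
  shows "summable (\<lambda>k. (x k + y k)\<^sup>2)"
proof -
  have "summable (\<lambda>k. (x k)\<^sup>2 + (y k)\<^sup>2 + 2 * (x k * y k))"
    using assms square_summable_mult[OF assms] by (intro summable_add summable_mult)
  then show ?thesis by (simp add: power2_sum mult.assoc)
qed

instantiation ell2 :: real_inner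
begin

lift_definition zero_ell2 :: ell2 is "\<lambda>_. 0"
  by simp

lift_definition plus_ell2 :: "ell2 \<Rightarrow> ell2 \<Rightarrow> ell2" is "\<lambda>x y k. x k + y k"
  by (rule square_summable_add)

lift_definition uminus_ell2 :: "ell2 \<Rightarrow> ell2" is "\<lambda>x k. - x k"
  by simp

lift_definition minus_ell2 :: "ell2 \<Rightarrow> ell2 \<Rightarrow> ell2" is "\<lambda>x y k. x k - y k"
  subgoal for x y
    using square_summable_add[of x "\<lambda>k. - y k"] by simp
  done

lift_definition scaleR_ell2 :: "real \<Rightarrow> ell2 \<Rightarrow> ell2" is "\<lambda>c x k. c * x k"
  by (simp add: power_mult_distrib summable_mult)

definition inner_ell2 :: "ell2 \<Rightarrow> ell2 \<Rightarrow> real" where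
  "inner_ell2 x y = (\<Sum>k. ell2_nth x k * ell2_nth y k)"

definition norm_ell2 :: "ell2 \<Rightarrow> real" where
  "norm_ell2 x = sqrt (\<Sum>k. (ell2_nth x k)\<^sup>2)"

definition dist_ell2 :: "ell2 \<Rightarrow> ell2 \<Rightarrow> real" where
  "dist_ell2 x y = norm (x - y)"

definition sgn_ell2 :: "ell2 \<Rightarrow> ell2" where
  "sgn_ell2 x = inverse (norm x) *\<^sub>R x"

definition uniformity_ell2 :: "(ell2 \<times> ell2) filter" where
  "uniformity_ell2 = (INF e\<in>{0 <..}. principal {(x, y). dist x y < e})"

definition open_ell2 :: "ell2 set \<Rightarrow> bool" where
  "open_ell2 U = (\<forall>x\<in>U. eventually (\<lambda>(x', y). x' = x \<longrightarrow> y \<in> U) uniformity)"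

instance
proof
  fix x y z :: ell2 and a b :: real
  show "x + y + z = x + (y + z)" "x + y = y + x" "0 + x = x" "- x + x = 0" "x - y = x + - y"
    "a *\<^sub>R (x + y) = a *\<^sub>R x + a *\<^sub>R y" "(a + b) *\<^sub>R x = a *\<^sub>R x + b *\<^sub>R x"
    "a *\<^sub>R b *\<^sub>R x = (a * b) *\<^sub>R x" "1 *\<^sub>R x = x"
    by (transfer; simp add: algebra_simps)+
  show "dist x y = norm (x - y)" by (rule dist_ell2_def)
  show "sgn x = inverse (norm x) *\<^sub>R x" by (rule sgn_ell2_def)
  show "(uniformity :: (ell2 \<times> ell2) filter) = (INF e\<in>{0 <..}. principal {(x, y). dist x y < e})"
    by (rule uniformity_ell2_def)
  note sm = square_summable_mult[OF summable_ell2 summable_ell2]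
  show "x \<bullet> y = y \<bullet> x"
    unfolding inner_ell2_def by (simp add: mult.commute)
  show "(x + y) \<bullet> z = x \<bullet> z + y \<bullet> z"
    unfolding inner_ell2_def by (simp add: plus_ell2.rep_eq distrib_right suminf_add sm)
  show "(a *\<^sub>R x) \<bullet> y = a * (x \<bullet> y)"
    unfolding inner_ell2_def by (simp add: scaleR_ell2.rep_eq mult.assoc suminf_mult sm)
  show "0 \<le> x \<bullet> x"
    unfolding inner_ell2_def by (rule suminf_nonneg[OF sm]) simp
  show "x \<bullet> x = 0 \<longleftrightarrow> x = 0"
    unfolding inner_ell2_def
    by (subst suminf_eq_zero_iff[OF sm])
      (auto simp: zero_ell2.rep_eq ell2_nth_inject[symmetric] fun_eq_iff)
  show "norm x = sqrt (x \<bullet> x)"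
    unfolding inner_ell2_def norm_ell2_def by (simp add: power2_eq_square)
  show "open U = (\<forall>x\<in>U. \<forall>\<^sub>F (x', y) in uniformity. x' = x \<longrightarrow> y \<in> U)" for U :: "ell2 set"
    by (rule open_ell2_def)
qed

end

lemma norm_ell2_sq: "(norm x)\<^sup>2 = (\<Sum>k. (ell2_nth x k)\<^sup>2)"
  unfolding norm_ell2_def by (simp add: suminf_nonneg[OF summable_ell2])

lemma sum_le_norm_ell2_sq: "(\<Sum>k<n. (ell2_nth x k)\<^sup>2) \<le> (norm x)\<^sup>2"
  unfolding norm_ell2_sq by (rule sum_le_suminf[OF summable_ell2]) auto

lemma abs_ell2_nth_le: "\<bar>ell2_nth x k\<bar> \<le> norm x"
proof -
  have "(ell2_nth x k)\<^sup>2 \<le> (\<Sum>j<Suc k. (ell2_nth x j)\<^sup>2)"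
    by (simp add: sum_nonneg)
  also have "\<dots> \<le> (norm x)\<^sup>2" by (rule sum_le_norm_ell2_sq)
  finally show ?thesis by (simp add: abs_le_square_iff[symmetric])
qed

instance ell2 :: banach
proof
  fix X :: "nat \<Rightarrow> ell2"
  assume C: "Cauchy X"
  have "convergent (\<lambda>n. ell2_nth (X n) k)" for k
  proof (rule Cauchy_convergent, rule metric_CauchyI)
    fix e :: real assume "0 < e"
    from metric_CauchyD[OF C this] obtain M where
      M: "\<And>m n. m \<ge> M \<Longrightarrow> n \<ge> M \<Longrightarrow> dist (X m) (X n) < e" by blast
    have "dist (ell2_nth (X m) k) (ell2_nth (X n) k) < e" if "m \<ge> M" "n \<ge> M" for m n
      using abs_ell2_nth_le[of "X m - X n" k] M[OF that]
      by (simp add: dist_norm minus_ell2.rep_eq)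
    then show "\<exists>M. \<forall>m\<ge>M. \<forall>n\<ge>M. dist (ell2_nth (X m) k) (ell2_nth (X n) k) < e" by blast
  qed
  then obtain L where L: "\<And>k. (\<lambda>n. ell2_nth (X n) k) \<longlonglongrightarrow> L k"
    unfolding convergent_def by metis
  have tail: "\<exists>M. \<forall>m\<ge>M. \<forall>K. (\<Sum>k<K. (ell2_nth (X m) k - L k)\<^sup>2) \<le> e\<^sup>2" if e: "0 < e" for e :: real
  proof -
    from metric_CauchyD[OF C e] obtain M where
      M: "\<And>m n. m \<ge> M \<Longrightarrow> n \<ge> M \<Longrightarrow> dist (X m) (X n) < e" by blast
    have "(\<Sum>k<K. (ell2_nth (X m) k - L k)\<^sup>2) \<le> e\<^sup>2" if m: "m \<ge> M" for m K
    proof (rule LIMSEQ_le_const2)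
      show "(\<lambda>n. \<Sum>k<K. (ell2_nth (X m) k - ell2_nth (X n) k)\<^sup>2)
          \<longlonglongrightarrow> (\<Sum>k<K. (ell2_nth (X m) k - L k)\<^sup>2)"
        by (intro tendsto_intros L)
      have "(\<Sum>k<K. (ell2_nth (X m) k - ell2_nth (X n) k)\<^sup>2) \<le> e\<^sup>2" if n: "n \<ge> M" for n
      proof -
        have "(\<Sum>k<K. (ell2_nth (X m) k - ell2_nth (X n) k)\<^sup>2) \<le> (norm (X m - X n))\<^sup>2"
          using sum_le_norm_ell2_sq[of "X m - X n" K] by (simp add: minus_ell2.rep_eq)
        also have "\<dots> \<le> e\<^sup>2"
          using M[OF m n] by (intro power_mono) (auto simp: dist_norm)
        finally show ?thesis .
      qed
      then show "\<exists>N. \<forall>n\<ge>N. (\<Sum>k<K. (ell2_nth (X m) k - ell2_nth (X n) k)\<^sup>2) \<le> e\<^sup>2" by blast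
    qed
    then show ?thesis by blast
  qed
  have diff: "summable (\<lambda>k. (ell2_nth (X m) k - L k)\<^sup>2)"
    if "\<forall>K. (\<Sum>k<K. (ell2_nth (X m) k - L k)\<^sup>2) \<le> c" for m c
  proof (rule bounded_imp_summable[where B = c])
    show "(\<Sum>k\<le>n. (ell2_nth (X m) k - L k)\<^sup>2) \<le> c" for n
      using that[rule_format, of "Suc n"] by (simp only: lessThan_Suc_atMost)
  qed simp
  from tail[of 1] obtain m0 where "\<forall>K. (\<Sum>k<K. (ell2_nth (X m0) k - L k)\<^sup>2) \<le> 1" by auto
  from diff[OF this] have "summable (\<lambda>k. (- (ell2_nth (X m0) k - L k))\<^sup>2)"
    by (simp only: power2_minus)
  from square_summable_add[OF summable_ell2[of "X m0"] this]
  have "summable (\<lambda>k. (L k)\<^sup>2)" by simp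
  then have nth_L: "ell2_nth (Abs_ell2 L) = L" by (simp add: Abs_ell2_inverse)
  have "X \<longlonglongrightarrow> Abs_ell2 L"
  proof (rule metric_LIMSEQ_I)
    fix r :: real assume r: "0 < r"
    then have "0 < r / 2" by simp
    from tail[OF this] obtain M where
      M: "\<And>m K. m \<ge> M \<Longrightarrow> (\<Sum>k<K. (ell2_nth (X m) k - L k)\<^sup>2) \<le> (r / 2)\<^sup>2" by blast
    have "dist (X m) (Abs_ell2 L) < r" if "m \<ge> M" for m
    proof -
      have "(norm (X m - Abs_ell2 L))\<^sup>2 \<le> (r / 2)\<^sup>2"
        unfolding norm_ell2_sq
        by (rule suminf_le_const[OF summable_ell2])
          (use M[OF that] in \<open>simp add: minus_ell2.rep_eq nth_L\<close>)
      then have "norm (X m - Abs_ell2 L) \<le> r / 2"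
        by (rule power2_le_imp_le) (use r in simp)
      then show ?thesis using r by (simp add: dist_norm)
    qed
    then show "\<exists>no. \<forall>n\<ge>no. dist (X n) (Abs_ell2 L) < r" by blast
  qed
  then show "convergent X" by (auto simp: convergent_def)
qed

definition mazur_op :: "(nat \<Rightarrow> ell2) \<Rightarrow> ell1 \<Rightarrow> ell2" where
  "mazur_op \<zeta> x = (\<Sum>k. ell1_nth x k *\<^sub>R \<zeta> k)"

text \<open>
  For unit vectors the series converges absolutely, so the value of \<^const>\<open>suminf\<close>
  above is its sum in \<open>ell2\<close>, and \<^const>\<open>mazur_op\<close> is a bounded linear operator.
\<close>

lemma summable_norm_mazur:
  assumes "range \<zeta> \<subseteq> sphere 0 1"
  shows "summable (\<lambda>k. norm (ell1_nth x k *\<^sub>R \<zeta> k))"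
proof -
  have "norm (\<zeta> k) = 1" for k using assms by (auto simp: image_subset_iff)
  then show ?thesis using summable_ell1[of x] by simp
qed

lemma mazur_op_sums:
  assumes "range \<zeta> \<subseteq> sphere 0 1"
  shows "(\<lambda>k. ell1_nth x k *\<^sub>R \<zeta> k) sums mazur_op \<zeta> x"
  unfolding mazur_op_def
  by (intro summable_sums summable_norm_cancel[OF summable_norm_mazur[OF assms]])

lemma bounded_linear_mazur_op:
  assumes "range \<zeta> \<subseteq> sphere 0 1"
  shows "bounded_linear (mazur_op \<zeta>)"
proof (rule bounded_linear_intro[where K = 1])
  note s = mazur_op_sums[OF assms]
  show "mazur_op \<zeta> (x + y) = mazur_op \<zeta> x + mazur_op \<zeta> y" for x y
    using sums_unique2[OF s[of "x + y"]] sums_add[OF s[of x] s[of y]]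
    by (simp add: plus_ell1.rep_eq scaleR_add_left)
  show "mazur_op \<zeta> (c *\<^sub>R x) = c *\<^sub>R mazur_op \<zeta> x" for c x
    using sums_unique2[OF s[of "c *\<^sub>R x"]]
      bounded_linear.sums[OF bounded_linear_scaleR_right s[of x], of c]
    by (simp add: scaleR_ell1.rep_eq)
  have nz: "norm (\<zeta> k) = 1" for k using assms by (auto simp: image_subset_iff)
  show "norm (mazur_op \<zeta> x) \<le> norm x * 1" for x
    unfolding mazur_op_def norm_ell1_def
    using summable_norm[OF summable_norm_mazur[OF assms, of x]] by (simp add: nz)
qed

definition min_norm_solution :: "(ell1 \<Rightarrow> ell2) \<Rightarrow> ell2 \<Rightarrow> ell1 \<Rightarrow> bool" where
  "min_norm_solution B y x\<^sub>m\<^sub>n \<longleftrightarrow> B x\<^sub>m\<^sub>n = y \<and> (\<forall>x. B x = y \<longrightarrow> norm x\<^sub>m\<^sub>n \<le> norm x)"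

end

theory Submission
  imports Defs
begin

text \<open>
  A solution \<open>x\<close> of \<open>B x = y\<close> always has \<open>\<parallel>x\<parallel> \<ge> \<parallel>y\<parallel>\<close>, since the \<open>\<zeta> k\<close> are unit vectors. The proof
  shows that \<open>\<parallel>y\<parallel>\<close> is the infimum of the norms of solutions, and that it is attained only if
  \<open>y\<close> is a multiple of some \<open>\<zeta> k\<close>.

  For the infimum, density of the \<open>\<zeta> k\<close> means that each vector is matched up to a relative error
  \<open>\<delta>\<close> by a multiple of a single \<open>\<zeta> k\<close>, at the cost of its own norm in \<open>\<ell>\<^sup>1\<close>. Repeating this on the
  residuals gives a geometric series of corrections, which converges because \<open>\<ell>\<^sup>1\<close> is complete, and
  whose sum is an exact solution of norm at most \<open>\<parallel>y\<parallel> / (1 - \<delta>)\<close>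
  (\<open>approximate_solutions_imp_exact_solution\<close>). A minimum-norm solution therefore has norm at
  most \<open>\<parallel>y\<parallel>\<close>.

  For the second part, such a solution \<open>x\<close> has equality in the triangle inequality
  \<open>\<parallel>\<Sum>k. x k *\<^sub>R \<zeta> k\<parallel> \<le> (\<Sum>k. \<bar>x k\<bar>)\<close>. Taking the inner product with \<open>y\<close> turns this into equality in
  the Cauchy-Schwarz inequality for \<open>y\<close> and every \<open>\<zeta> k\<close> with \<open>x k \<noteq> 0\<close>, so that \<open>y\<close> is parallel to
  all of these \<open>\<zeta> k\<close> (\<open>mazur_op_norm_attained_imp_multiple\<close>).
\<close>

section \<open>Completeness of the space of absolutely summable sequences\<close>

lemma sum_le_norm_ell1: "(\<Sum>k<n. \<bar>ell1_nth x k\<bar>) \<le> norm x"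
  unfolding norm_ell1_def by (rule sum_le_suminf[OF summable_ell1]) auto

lemma abs_ell1_nth_le: "\<bar>ell1_nth x k\<bar> \<le> norm x"
proof -
  have "\<bar>ell1_nth x k\<bar> \<le> (\<Sum>j<Suc k. \<bar>ell1_nth x j\<bar>)"
    by (simp add: sum_nonneg)
  also have "\<dots> \<le> norm x" by (rule sum_le_norm_ell1)
  finally show ?thesis .
qed

text \<open>
  Coordinates of a Cauchy sequence converge. The Cauchy estimate bounds finite sections of the
  differences, so it survives the coordinatewise limit; this bound on all sections both puts
  the limit into \<open>\<ell>\<^sup>1\<close> and gives convergence in norm.
\<close>

instance ell1 :: banach
proof
  fix X :: "nat \<Rightarrow> ell1"
  assume C: "Cauchy X"
  have "convergent (\<lambda>n. ell1_nth (X n) k)" for k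
  proof (rule Cauchy_convergent, rule metric_CauchyI)
    fix e :: real assume "0 < e"
    from metric_CauchyD[OF C this] obtain M where
      M: "\<And>m n. m \<ge> M \<Longrightarrow> n \<ge> M \<Longrightarrow> dist (X m) (X n) < e" by blast
    have "dist (ell1_nth (X m) k) (ell1_nth (X n) k) < e" if "m \<ge> M" "n \<ge> M" for m n
      using abs_ell1_nth_le[of "X m - X n" k] M[OF that]
      by (simp add: dist_norm minus_ell1.rep_eq)
    then show "\<exists>M. \<forall>m\<ge>M. \<forall>n\<ge>M. dist (ell1_nth (X m) k) (ell1_nth (X n) k) < e" by blast
  qed
  then obtain L where L: "\<And>k. (\<lambda>n. ell1_nth (X n) k) \<longlonglongrightarrow> L k"
    unfolding convergent_def by metis
  have tail: "\<exists>M. \<forall>m\<ge>M. \<forall>K. (\<Sum>k<K. \<bar>ell1_nth (X m) k - L k\<bar>) \<le> e" if e: "0 < e" for e :: real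
  proof -
    from metric_CauchyD[OF C e] obtain M where
      M: "\<And>m n. m \<ge> M \<Longrightarrow> n \<ge> M \<Longrightarrow> dist (X m) (X n) < e" by blast
    have "(\<Sum>k<K. \<bar>ell1_nth (X m) k - L k\<bar>) \<le> e" if m: "m \<ge> M" for m K
    proof (rule LIMSEQ_le_const2)
      show "(\<lambda>n. \<Sum>k<K. \<bar>ell1_nth (X m) k - ell1_nth (X n) k\<bar>)
          \<longlonglongrightarrow> (\<Sum>k<K. \<bar>ell1_nth (X m) k - L k\<bar>)"
        by (intro tendsto_intros L)
      have "(\<Sum>k<K. \<bar>ell1_nth (X m) k - ell1_nth (X n) k\<bar>) \<le> e" if n: "n \<ge> M" for n
        using sum_le_norm_ell1[of "X m - X n" K] M[OF m n]
        by (simp add: minus_ell1.rep_eq dist_norm)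
      then show "\<exists>N. \<forall>n\<ge>N. (\<Sum>k<K. \<bar>ell1_nth (X m) k - ell1_nth (X n) k\<bar>) \<le> e" by blast
    qed
    then show ?thesis by blast
  qed
  from tail[of 1] obtain m0 where m0: "\<forall>K. (\<Sum>k<K. \<bar>ell1_nth (X m0) k - L k\<bar>) \<le> 1" by auto
  have "summable (\<lambda>k. \<bar>ell1_nth (X m0) k - L k\<bar>)"
  proof (rule bounded_imp_summable[where B = 1])
    show "(\<Sum>k\<le>n. \<bar>ell1_nth (X m0) k - L k\<bar>) \<le> 1" for n
      using m0[rule_format, of "Suc n"] by (simp only: lessThan_Suc_atMost)
  qed simp
  from summable_add[OF summable_ell1[of "X m0"] this]
  have "summable (\<lambda>k. \<bar>L k\<bar>)"
    by (rule summable_comparison_test') auto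
  then have nth_L: "ell1_nth (Abs_ell1 L) = L" by (simp add: Abs_ell1_inverse)
  have "X \<longlonglongrightarrow> Abs_ell1 L"
  proof (rule metric_LIMSEQ_I)
    fix r :: real assume r: "0 < r"
    then have "0 < r / 2" by simp
    from tail[OF this] obtain M where
      M: "\<And>m K. m \<ge> M \<Longrightarrow> (\<Sum>k<K. \<bar>ell1_nth (X m) k - L k\<bar>) \<le> r / 2" by blast
    have "dist (X m) (Abs_ell1 L) < r" if "m \<ge> M" for m
    proof -
      have "norm (X m - Abs_ell1 L) \<le> r / 2"
        unfolding norm_ell1_def
        by (rule suminf_le_const[OF summable_ell1])
          (use M[OF that] in \<open>simp add: minus_ell1.rep_eq nth_L\<close>)
      then show ?thesis using r by (simp add: dist_norm)
    qed
    then show "\<exists>no. \<forall>n\<ge>no. dist (X n) (Abs_ell1 L) < r" by blast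
  qed
  then show "convergent X" by (auto simp: convergent_def)
qed

section \<open>Unit sequences\<close>

lift_definition ell1_unit :: "nat \<Rightarrow> ell1" is "\<lambda>k j. if j = k then 1 else 0"
proof -
  fix k :: nat
  show "summable (\<lambda>j. \<bar>if j = k then 1 else 0 :: real\<bar>)"
    by (rule summable_finite[of "{k}"]) auto
qed

lemma norm_ell1_unit: "norm (ell1_unit k) = 1"
proof -
  have "(\<lambda>j. \<bar>ell1_nth (ell1_unit k) j\<bar>) = (\<lambda>j. if j = k then 1 else 0)"
    by (auto simp: ell1_unit.rep_eq)
  then show ?thesis
    using sums_single[of k "\<lambda>_. 1 :: real"] by (simp add: norm_ell1_def sums_iff)
qed

lemma mazur_op_ell1_unit: "mazur_op \<zeta> (ell1_unit k) = \<zeta> k"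
proof -
  have "(\<lambda>j. ell1_nth (ell1_unit k) j *\<^sub>R \<zeta> j) = (\<lambda>j. if j = k then \<zeta> j else 0)"
    by (auto simp: ell1_unit.rep_eq)
  then show ?thesis
    using sums_single[of k \<zeta>] by (simp add: mazur_op_def sums_iff)
qed

section \<open>Solutions of almost minimal norm\<close>

text \<open>
  This is the successive approximation step of the open mapping theorem, with explicit constants.
  Each residual has norm at most \<open>\<delta>\<close> times that of the one before, so the corrections form a geometric
  series, and the images of the corrections telescope to \<open>y\<close>.
\<close>

lemma approximate_solutions_imp_exact_solution:
  fixes T :: "'a::banach \<Rightarrow> 'b::real_normed_vector"
  assumes T: "bounded_linear T" and \<delta>: "0 \<le> \<delta>" "\<delta> < 1"
    and approx: "\<And>z. \<exists>x. norm x \<le> norm z \<and> norm (z - T x) \<le> \<delta> * norm z"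
  shows "\<exists>x. T x = y \<and> norm x \<le> norm y / (1 - \<delta>)"
proof -
  from approx obtain s where
    s: "\<And>z. norm (s z) \<le> norm z" "\<And>z. norm (z - T (s z)) \<le> \<delta> * norm z"
    by metis
  define r where "r n = ((\<lambda>z. z - T (s z)) ^^ n) y" for n
  have r_Suc: "r (Suc n) = r n - T (s (r n))" for n
    by (simp add: r_def)
  have r_le: "norm (r n) \<le> norm y * \<delta> ^ n" for n
  proof (induction n)
    case 0
    show ?case by (simp add: r_def)
  next
    case (Suc n)
    have "norm (r (Suc n)) \<le> \<delta> * norm (r n)"
      using s(2)[of "r n"] by (simp add: r_Suc)
    also have "\<dots> \<le> \<delta> * (norm y * \<delta> ^ n)"
      using Suc.IH \<delta>(1) by (rule mult_left_mono)
    finally show ?case by (simp add: mult_ac)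
  qed
  have s_le: "norm (s (r n)) \<le> norm y * \<delta> ^ n" for n
    using s(1)[of "r n"] r_le[of n] by linarith
  have geom: "(\<lambda>n. norm y * \<delta> ^ n) sums (norm y / (1 - \<delta>))"
    using sums_mult[OF geometric_sums[of \<delta>], of "norm y"] \<delta> by simp
  have sum_s: "summable (\<lambda>n. norm (s (r n)))"
    using sums_summable[OF geom] by (rule summable_comparison_test') (simp add: s_le)
  define x where "x = (\<Sum>n. s (r n))"
  have "norm x \<le> (\<Sum>n. norm (s (r n)))"
    unfolding x_def by (rule summable_norm[OF sum_s])
  also have "\<dots> \<le> norm y / (1 - \<delta>)"
    using suminf_le[OF s_le sum_s sums_summable[OF geom]] geom by (simp add: sums_iff)
  finally have norm_x: "norm x \<le> norm y / (1 - \<delta>)" .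
  have "(\<lambda>n. norm y * \<delta> ^ n) \<longlonglongrightarrow> 0"
    using summable_LIMSEQ_zero[OF sums_summable[OF geom]] .
  then have "r \<longlonglongrightarrow> 0"
    by (rule Lim_null_comparison[rotated]) (simp add: r_le)
  from telescope_sums'[OF this] have "(\<lambda>n. T (s (r n))) sums y"
    by (simp add: r_Suc) (simp add: r_def)
  moreover have "(\<lambda>n. T (s (r n))) sums T x"
    unfolding x_def
    using bounded_linear.sums[OF T summable_sums[OF summable_norm_cancel[OF sum_s]]] .
  ultimately have "T x = y"
    using sums_unique2 by blast
  with norm_x show ?thesis by blast
qed

text \<open>
  Dense unit vectors supply the approximations: for \<open>z \<noteq> 0\<close>, pick \<open>\<zeta> k\<close> within \<open>\<delta>\<close> of the
  direction of \<open>z\<close>.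
\<close>

lemma mazur_op_almost_isometric_solution:
  assumes unit: "range \<zeta> \<subseteq> sphere 0 1"
    and dense: "sphere 0 1 \<subseteq> closure (range \<zeta>)"
    and \<delta>: "0 < \<delta>" "\<delta> < 1"
  shows "\<exists>x. mazur_op \<zeta> x = y \<and> norm x \<le> norm y / (1 - \<delta>)"
proof (rule approximate_solutions_imp_exact_solution[OF bounded_linear_mazur_op[OF unit]])
  fix z :: ell2
  show "\<exists>x. norm x \<le> norm z \<and> norm (z - mazur_op \<zeta> x) \<le> \<delta> * norm z"
  proof (cases "z = 0")
    case True
    then show ?thesis
      using linear_simps(3)[OF bounded_linear_mazur_op[OF unit]] by (intro exI[of _ 0]) simp
  next
    case False
    define u where "u = inverse (norm z) *\<^sub>R z"
    have z: "z = norm z *\<^sub>R u" using False by (simp add: u_def)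
    have "u \<in> closure (range \<zeta>)"
      using dense False by (auto simp: u_def)
    then obtain k where k: "norm (u - \<zeta> k) < \<delta>"
      using \<delta>(1) by (auto simp: closure_approachable dist_norm norm_minus_commute)
    let ?x = "norm z *\<^sub>R ell1_unit k"
    have "z - mazur_op \<zeta> ?x = norm z *\<^sub>R (u - \<zeta> k)"
      using linear_simps(5)[OF bounded_linear_mazur_op[OF unit]] z
      by (simp add: mazur_op_ell1_unit scaleR_diff_right)
    then have "norm (z - mazur_op \<zeta> ?x) = norm z * norm (u - \<zeta> k)" by simp
    also have "\<dots> \<le> norm z * \<delta>"
      using k by (intro mult_left_mono) auto
    finally have "norm (z - mazur_op \<zeta> ?x) \<le> \<delta> * norm z" by (simp add: mult.commute)
    then show ?thesis by (intro exI[of _ ?x]) (simp add: norm_ell1_unit)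
  qed
qed (use \<delta> in auto)

lemma min_norm_solution_mazur_op_norm_le:
  assumes unit: "range \<zeta> \<subseteq> sphere 0 1"
    and dense: "sphere 0 1 \<subseteq> closure (range \<zeta>)"
    and min: "min_norm_solution (mazur_op \<zeta>) y x"
  shows "norm x \<le> norm y"
proof (rule field_le_mult_one_interval)
  fix t :: real
  assume t: "0 < t" "t < 1"
  obtain x' where "mazur_op \<zeta> x' = y" "norm x' \<le> norm y / t"
    using mazur_op_almost_isometric_solution[OF unit dense, of "1 - t" y] t by auto
  then have "norm x \<le> norm y / t"
    using min by (force simp: min_norm_solution_def)
  then show "t * norm x \<le> norm y"
    using t by (simp add: field_simps)
qed

section \<open>Attainment of the lower bound\<close>

text \<open>
  The defects \<open>\<bar>x k\<bar> \<parallel>y\<parallel> - x k (\<zeta> k \<bullet> y)\<close> are nonnegative by Cauchy-Schwarz, and they add up to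
  \<open>\<parallel>x\<parallel> \<parallel>y\<parallel> - \<parallel>y\<parallel>\<^sup>2 \<le> 0\<close>. So all of them vanish.
\<close>

lemma mazur_op_norm_attained_imp_multiple:
  assumes unit: "range \<zeta> \<subseteq> sphere 0 1"
    and le: "norm x \<le> norm (mazur_op \<zeta> x)"
  shows "\<exists>k c. mazur_op \<zeta> x = c *\<^sub>R \<zeta> k"
proof (cases "x = 0")
  case True
  then show ?thesis
    using linear_simps(3)[OF bounded_linear_mazur_op[OF unit]] by (intro exI[of _ 0]) simp
next
  case False
  define y where "y = mazur_op \<zeta> x"
  have nz: "norm (\<zeta> k) = 1" for k using unit by (auto simp: image_subset_iff)
  define d where "d k = \<bar>ell1_nth x k\<bar> * norm y - ell1_nth x k * (\<zeta> k \<bullet> y)" for k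
  have d_nonneg: "0 \<le> d k" for k
  proof -
    have "ell1_nth x k * (\<zeta> k \<bullet> y) \<le> \<bar>ell1_nth x k\<bar> * \<bar>\<zeta> k \<bullet> y\<bar>"
      by (metis abs_ge_self abs_mult)
    also have "\<dots> \<le> \<bar>ell1_nth x k\<bar> * norm y"
      using Cauchy_Schwarz_ineq2[of "\<zeta> k" y] by (intro mult_left_mono) (auto simp: nz)
    finally show ?thesis by (simp add: d_def)
  qed
  have "(\<lambda>k. \<bar>ell1_nth x k\<bar> * norm y) sums (norm x * norm y)"
    unfolding norm_ell1_def by (intro sums_mult2 summable_sums summable_ell1)
  moreover have "(\<lambda>k. ell1_nth x k * (\<zeta> k \<bullet> y)) sums (y \<bullet> y)"
    using bounded_linear.sums[OF bounded_linear_inner_left mazur_op_sums[OF unit, of x], of y]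
    by (simp add: y_def)
  ultimately have d_sums: "d sums (norm x * norm y - y \<bullet> y)"
    unfolding d_def by (rule sums_diff)
  have "norm x * norm y \<le> y \<bullet> y"
    using mult_right_mono[OF le, of "norm y"]
    by (simp add: y_def power2_norm_eq_inner[symmetric] power2_eq_square)
  moreover have "0 \<le> norm x * norm y - y \<bullet> y"
    using sums_le[OF _ sums_zero d_sums] d_nonneg by blast
  ultimately have "d sums 0" using d_sums by simp
  then have d_zero: "d k = 0" for k
    using suminf_eq_zero_iff[of d] d_nonneg by (auto simp: sums_iff)
  obtain k where k: "ell1_nth x k \<noteq> 0"
    using False by (auto simp: zero_ell1.rep_eq ell1_nth_inject[symmetric] fun_eq_iff)
  have "\<bar>ell1_nth x k\<bar> * norm y = \<bar>ell1_nth x k\<bar> * \<bar>\<zeta> k \<bullet> y\<bar>"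
    using d_zero[of k] by (metis abs_mult abs_norm_cancel abs_abs d_def eq_iff_diff_eq_0)
  then have "\<bar>\<zeta> k \<bullet> y\<bar> = norm (\<zeta> k) * norm y" using k by (simp add: nz)
  then have "y = norm y *\<^sub>R \<zeta> k \<or> y = (- norm y) *\<^sub>R \<zeta> k"
    unfolding norm_cauchy_schwarz_abs_eq by (auto simp: nz)
  then show ?thesis unfolding y_def by blast
qed

section \<open>Nonexistence of minimum-norm solutions\<close>

theorem proposition4p1:
  fixes \<zeta> :: "nat \<Rightarrow> ell2" and y :: ell2
  assumes "inj \<zeta>"
    and "range \<zeta> \<subseteq> sphere 0 1"
    and "sphere 0 1 \<subseteq> closure (range \<zeta>)"
    and "\<not> (\<exists>k c. y = c *\<^sub>R \<zeta> k)"
  shows "\<not> (\<exists>x\<^sub>m\<^sub>n. min_norm_solution (mazur_op \<zeta>) y x\<^sub>m\<^sub>n)"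
proof
  assume "\<exists>x. min_norm_solution (mazur_op \<zeta>) y x"
  then obtain x where x: "min_norm_solution (mazur_op \<zeta>) y x" ..
  then have "mazur_op \<zeta> x = y" by (simp add: min_norm_solution_def)
  with min_norm_solution_mazur_op_norm_le[OF assms(2,3) x]
  have "\<exists>k c. y = c *\<^sub>R \<zeta> k"
    using mazur_op_norm_attained_imp_multiple[OF assms(2), of x] by simp
  with assms(4) show False ..
qed

end
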